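(* Let $a>0$, let $w$ be a nonzero real number, let $n\ge 1$ be an integer, let $f\in C^1[0,a]$, and let $0\le \hat x_0<\hat x_1<\dots<\hat x_{n-1}\le a$ be arbitrary points. Let $Q^{[0,a],L}_{\log,w,n}[f]$ be the new Levin approximation and $Q^{[0,a],F}_{\log,w,n}[f]$ the Filon approximation of $\int_0^a f(x)\log(x)e^{iwx}\,dx$, both based on the points $\hat x_0,\dots,\hat x_{n-1}$ (as defined in the context). Then $$Q^{[0,a],L}_{\log,w,n}[f]=Q^{[0,a],F}_{\log,w,n}[f].$$
   Context: Filon method: let $\hat f$ be the polynomial of degree at most $n-1$ with $\hat f(\hat x_j)=f(\hat x_j)$, $j=0,\dots,n-1$. Then $Q^{[0,a],F}_{\log,w,n}[f]:=\int_0^a \hat f(x)\log(x)e^{iwx}\,dx$. New Levin method (linear oscillator $g(x)=x$), all linear systems being solved exactly: (1) $\hat q_1$ is the polynomial of degree at most $n-1$ with $\hat q_1'(\hat x_j)+iw\,\hat q_1(\hat x_j)=f(\hat x_j)$ for $j=0,\dots,n-1$. (2) $\hat q_2(x):=\frac{\hat q_1(x)-\hat q_1(0)}{x}$ for $x\ne0$ and $\hat q_2(0):=\hat q_1'(0)$; this is a polynomial. (3) $\hat h_1$ is the polynomial of degree at most $n-1$ with $\hat h_1'(\hat x_j)+iw\,\hat h_1(\hat x_j)=-\hat q_2(\hat x_j)$ for $j=0,\dots,n-1$. (4) $\hat h_2(x):=\hat q_1(0)e^{-iwx}\left(\gamma+\Gamma(0,-iwx)+\operatorname{Log}(-iwx)\right)$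 for $x\neq0$ and $\hat h_2(0):=0$, where $\gamma$ is Euler's constant, $\operatorname{Log}(z)=\log|z|+i\arg(z)$ is the principal logarithm, and $\Gamma(0,z)=\int_z^\infty e^{-t}t^{-1}\,dt$ is the complementary incomplete Gamma function (principal branch), with $\Gamma(0,z)=-\gamma-\operatorname{Log}(z)-\sum_{j\ge1}\frac{(-z)^j}{j\,(j!)}$. (5) With $\hat q(x):=\hat q_1(x)-\hat q_1(0)e^{-iwx}$ (so $\hat q(0)=0$ and $\hat q(x)\log x\to0$ as $x\to0^+$), $$Q^{[0,a],L}_{\log,w,n}[f]:=\Big[\hat q(x)e^{iwx}\log x+\hat h_1(x)e^{iwx}+\hat h_2(x)e^{iwx}\Big]_{x=0}^{x=a}=e^{iwa}\big(\hat q_1(a)\log a+\hat h_1(a)+\hat h_2(a)\big)-\big(\hat q_1(0)\log a+\hat h_1(0)\big),$$ where the value at $x=0$ of the first term is understood as its limit $0$. *)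

theory Defs
  imports "HOL-Complex_Analysis.Complex_Analysis" "HOL-Real_Asymp.Real_Asymp"
begin

definition osc :: "real \<Rightarrow> real \<Rightarrow> complex" where
  "osc w x = exp (\<i> * of_real w * of_real x)"

text \<open>
  For distinct nodes \<open>X 0, \<dots>, X (n - 1)\<close> with \<open>n \<ge> 1\<close>, and \<open>w \<noteq> 0\<close> in the second definition,
  exactly one polynomial satisfies the condition under \<open>THE\<close>: on the space of polynomials of
  degree at most \<open>n - 1\<close>, interpolation at the nodes and the operator \<open>p \<mapsto> p' + \<i> w p\<close> are
  bijective.
\<close>

definition interp_poly :: "nat \<Rightarrow> (nat \<Rightarrow> real) \<Rightarrow> (real \<Rightarrow> complex) \<Rightarrow> complex poly" where
  "interp_poly n X f =
     (THE p. degree p \<le> n - 1 \<and> (\<forall>j<n. poly p (of_real (X j)) = f (X j)))"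

definition collocation_poly ::
  "real \<Rightarrow> nat \<Rightarrow> (nat \<Rightarrow> real) \<Rightarrow> (real \<Rightarrow> complex) \<Rightarrow> complex poly" where
  "collocation_poly w n X r =
     (THE p. degree p \<le> n - 1 \<and>
        (\<forall>j<n. poly (pderiv p) (of_real (X j)) + \<i> * of_real w * poly p (of_real (X j)) = r (X j)))"

definition filon_quadrature ::
  "real \<Rightarrow> real \<Rightarrow> nat \<Rightarrow> (nat \<Rightarrow> real) \<Rightarrow> (real \<Rightarrow> complex) \<Rightarrow> complex" where
  "filon_quadrature a w n X f =
     integral {0..a} (\<lambda>x. poly (interp_poly n X f) (of_real x) * of_real (ln x) * osc w x)"

text \<open>
  The complementary incomplete Gamma function \<open>\<Gamma>(0, z) = \<integral>\<^sub>z\<^sup>\<infinity> e\<^sup>-\<^sup>t / t dt\<close>, integrated along the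
  horizontal ray \<open>t = z + s\<close>, \<open>s \<ge> 0\<close>. For \<open>z\<close> off the cut \<open>(-\<infinity>, 0]\<close> the ray does not
  meet the cut, so this is the principal branch; the definition is meant for such \<open>z\<close> only.
\<close>

definition Gamma_inc0 :: "complex \<Rightarrow> complex" where
  "Gamma_inc0 z = integral {0..} (\<lambda>s::real. exp (- (z + of_real s)) / (z + of_real s))"

definition levin_q1 ::
  "real \<Rightarrow> nat \<Rightarrow> (nat \<Rightarrow> real) \<Rightarrow> (real \<Rightarrow> complex) \<Rightarrow> complex poly" where
  "levin_q1 w n X f = collocation_poly w n X f"

definition levin_q2 ::
  "real \<Rightarrow> nat \<Rightarrow> (nat \<Rightarrow> real) \<Rightarrow> (real \<Rightarrow> complex) \<Rightarrow> real \<Rightarrow> complex" where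
  "levin_q2 w n X f x =
     (let q1 = levin_q1 w n X f in
      if x = 0 then poly (pderiv q1) 0 else (poly q1 (of_real x) - poly q1 0) / of_real x)"

definition levin_h1 ::
  "real \<Rightarrow> nat \<Rightarrow> (nat \<Rightarrow> real) \<Rightarrow> (real \<Rightarrow> complex) \<Rightarrow> complex poly" where
  "levin_h1 w n X f = collocation_poly w n X (\<lambda>x. - levin_q2 w n X f x)"

definition levin_h2 ::
  "real \<Rightarrow> nat \<Rightarrow> (nat \<Rightarrow> real) \<Rightarrow> (real \<Rightarrow> complex) \<Rightarrow> real \<Rightarrow> complex" where
  "levin_h2 w n X f x =
     (if x = 0 then 0
      else (let z = - \<i> * of_real w * of_real x in
        poly (levin_q1 w n X f) 0 * exp z * (euler_mascheroni + Gamma_inc0 z + Ln z)))"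

definition levin_q ::
  "real \<Rightarrow> nat \<Rightarrow> (nat \<Rightarrow> real) \<Rightarrow> (real \<Rightarrow> complex) \<Rightarrow> real \<Rightarrow> complex" where
  "levin_q w n X f x =
     poly (levin_q1 w n X f) (of_real x) - poly (levin_q1 w n X f) 0 * osc w (- x)"

text \<open>
  At \<open>x = 0\<close> the logarithmic term is replaced by its limit from the right, which is \<open>0\<close> since
  \<open>levin_q\<close> vanishes there.
\<close>

definition levin_primitive ::
  "real \<Rightarrow> nat \<Rightarrow> (nat \<Rightarrow> real) \<Rightarrow> (real \<Rightarrow> complex) \<Rightarrow> real \<Rightarrow> complex" where
  "levin_primitive w n X f x =
     (if x = 0 then 0 else levin_q w n X f x * osc w x * of_real (ln x))
     + poly (levin_h1 w n X f) (of_real x) * osc w x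
     + levin_h2 w n X f x * osc w x"

definition levin_quadrature ::
  "real \<Rightarrow> real \<Rightarrow> nat \<Rightarrow> (nat \<Rightarrow> real) \<Rightarrow> (real \<Rightarrow> complex) \<Rightarrow> complex" where
  "levin_quadrature a w n X f = levin_primitive w n X f a - levin_primitive w n X f 0"

lemma levin_log_term_tendsto_0:
  "((\<lambda>x. levin_q w n X f x * osc w x * of_real (ln x)) \<longlongrightarrow> 0) (at_right 0)"
proof -
  define q where "q = levin_q1 w n X f"
  define G where "G = (\<lambda>z. poly q z * exp (\<i> * of_real w * z) - poly q 0)"
  have G: "levin_q w n X f x * osc w x = G (of_real x)" for x
    by (simp add: levin_q_def osc_def G_def q_def left_diff_distrib mult.assoc flip: exp_add)
  have "\<exists>D. (G has_field_derivative D) (at 0)"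
    unfolding G_def by (auto intro!: exI derivative_eq_intros)
  then obtain D where "(G has_field_derivative D) (at 0)" by blast
  hence "((\<lambda>z. G z / z) \<longlongrightarrow> D) (at 0)"
    by (simp add: DERIV_def G_def)
  moreover have "filterlim (\<lambda>x::real. complex_of_real x) (at 0) (at_right 0)"
    by (auto simp: filterlim_at eventually_at_filter intro!: tendsto_eq_intros)
  ultimately have "((\<lambda>x. G (of_real x) / of_real x) \<longlongrightarrow> D) (at_right (0::real))"
    by (rule filterlim_compose)
  moreover have "((\<lambda>x::real. x * ln x) \<longlongrightarrow> 0) (at_right 0)"
    by real_asymp
  ultimately have "((\<lambda>x. (G (of_real x) / of_real x) * complex_of_real (x * ln x)) \<longlongrightarrow> D * of_real 0)
      (at_right 0)"
    by (intro tendsto_mult tendsto_of_real)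
  hence "((\<lambda>x. (G (of_real x) / of_real x) * complex_of_real (x * ln x)) \<longlongrightarrow> 0) (at_right 0)"
    by simp
  moreover have "\<forall>\<^sub>F x in at_right (0::real).
      (G (of_real x) / of_real x) * complex_of_real (x * ln x)
        = levin_q w n X f x * osc w x * of_real (ln x)"
    by (auto simp: eventually_at_filter G)
  ultimately show ?thesis
    by (rule Lim_transform_eventually)
qed

lemma levin_quadrature_explicit:
  assumes "a \<noteq> 0"
  shows "levin_quadrature a w n X f =
    osc w a * (poly (levin_q1 w n X f) (of_real a) * of_real (ln a)
      + poly (levin_h1 w n X f) (of_real a) + levin_h2 w n X f a)
    - (poly (levin_q1 w n X f) 0 * of_real (ln a) + poly (levin_h1 w n X f) 0)"
proof -
  have "osc w (- a) * osc w a = 1"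
    by (simp add: osc_def flip: exp_add)
  moreover have "osc w 0 = 1"
    by (simp add: osc_def)
  moreover have "levin_h2 w n X f 0 = 0"
    by (simp add: levin_h2_def)
  ultimately show ?thesis
    using assms
    by (simp add: levin_quadrature_def levin_primitive_def levin_q_def algebra_simps)
qed

end

theory Submission
  imports Defs
begin

text \<open>
  Since \<open>p \<mapsto> p' + \<i> w p\<close> preserves the degree, the collocation equations hold identically:
  \<open>q\<^sub>1' + \<i> w q\<^sub>1\<close> is the interpolant of \<open>f\<close>, and \<open>h\<^sub>1' + \<i> w h\<^sub>1 = - q\<^sub>2\<close> because \<open>q\<^sub>2\<close> is itself a
  polynomial of degree at most \<open>n - 1\<close>. With \<open>\<gamma> + \<Gamma>(0, z) + Log z = Ein z\<close>, where
  \<open>Ein' z = (1 - e\<^sup>-\<^sup>z) / z\<close>, the function in the Levin bracket is therefore a primitive of the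
  Filon integrand on \<open>(0, a)\<close>, continuous up to the endpoints.

  The identity for \<open>\<Gamma>(0, z)\<close> holds because \<open>Log z - Ein z\<close> is a primitive of \<open>e\<^sup>-\<^sup>z / z\<close>. Its limit
  \<open>- \<gamma>\<close> at infinity comes from comparing \<open>Ein n\<close> with the \<open>n\<close>-th harmonic number.
\<close>

section \<open>Interpolation and collocation polynomials\<close>

text \<open>Newton's scheme: the nodal polynomial \<open>v\<close> of the earlier nodes vanishes at
  all of them but not at the new node, so a multiple of it corrects the value there.\<close>

lemma ex_interpolating_poly:
  fixes X :: "nat \<Rightarrow> 'a::field" and Y :: "nat \<Rightarrow> 'a"
  assumes "inj_on X {..<n}"
  shows "\<exists>p. degree p \<le> n - 1 \<and> (\<forall>j<n. poly p (X j) = Y j)"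
  using assms
proof (induction n)
  case 0
  show ?case by (auto intro: exI[of _ 0])
next
  case (Suc n)
  then have "inj_on X {..<n}"
    by (auto simp: inj_on_def)
  then obtain p where p: "degree p \<le> n - 1" "\<And>j. j < n \<Longrightarrow> poly p (X j) = Y j"
    using Suc.IH by blast
  define v where "v = (\<Prod>j<n. [:- X j, 1:])"
  have v0: "poly v (X j) = 0" if "j < n" for j
    using that by (auto simp: v_def poly_prod)
  have "X n \<noteq> X j" if "j < n" for j
    using that inj_on_eq_iff[OF Suc.prems, of n j] by simp
  then have vn: "poly v (X n) \<noteq> 0"
    by (auto simp: v_def poly_prod)
  have "degree v \<le> n"
    using degree_prod_sum_le[of "{..<n}" "\<lambda>j. [:- X j, 1:]"] by (simp add: v_def)
  then have deg: "degree (p + smult c v) \<le> n" for c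
    using p(1) by (intro degree_add_le order_trans[OF degree_smult_le]) auto
  show ?case
  proof (intro exI conjI allI impI)
    let ?p = "p + smult ((Y n - poly p (X n)) / poly v (X n)) v"
    show "degree ?p \<le> Suc n - 1"
      using deg by simp
    show "poly ?p (X j) = Y j" if "j < Suc n" for j
      using that p(2) v0 vn by (cases "j = n") auto
  qed
qed

lemma interp_poly_eqI:
  assumes "n \<ge> 1" "inj_on X {..<n}" "degree p \<le> n - 1"
    and "\<And>j. j < n \<Longrightarrow> poly p (of_real (X j)) = f (X j)"
  shows "interp_poly n X f = p"
  unfolding interp_poly_def
proof (rule the_equality)
  fix q
  assume q: "degree q \<le> n - 1 \<and> (\<forall>j<n. poly q (of_real (X j)) = f (X j))"
  have "card ((\<lambda>j. complex_of_real (X j)) ` {..<n}) = n"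
    using assms(2) by (subst card_image) (auto simp: inj_on_def)
  then show "q = p"
    using assms q
    by (intro poly_eqI_degree[where A = "(\<lambda>j. complex_of_real (X j)) ` {..<n}"]) auto
qed (use assms in auto)

text \<open>Differentiation lowers the degree, so the leading term of \<open>smult c p\<close>
  survives. Constants are a separate case, as the degree of their derivative is not smaller.\<close>

lemma degree_pderiv_plus_smult:
  fixes p :: "'a::field_char_0 poly"
  assumes "c \<noteq> 0"
  shows "degree (pderiv p + smult c p) = degree p"
proof (cases "degree p = 0")
  case True
  then have "pderiv p = 0"
    by (simp add: pderiv_eq_0_iff)
  then show ?thesis
    using assms by simp
next
  case False
  then show ?thesis
    using assms by (intro degree_add_eq_right[THEN trans]) (auto simp: degree_pderiv)
qed

lemma pderiv_plus_smult_eq_iff: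
  fixes p q :: "'a::field_char_0 poly"
  assumes "c \<noteq> 0"
  shows "pderiv p + smult c p = pderiv q + smult c q \<longleftrightarrow> p = q"
proof
  assume eq: "pderiv p + smult c p = pderiv q + smult c q"
  then have 0: "pderiv (p - q) + smult c (p - q) = 0"
    by (simp add: pderiv_diff smult_diff_right algebra_simps)
  then have "degree (p - q) = 0"
    using degree_pderiv_plus_smult[OF assms, of "p - q"] by simp
  then have "pderiv (p - q) = 0"
    by (simp add: pderiv_eq_0_iff)
  then show "p = q"
    using 0 assms by simp
qed simp

text \<open>The candidate r/c solves the equation up to the error r'/c, which has smaller degree and
  is removed by the induction hypothesis.\<close>

lemma ex_pderiv_plus_smult_eq:
  fixes r :: "'a::field_char_0 poly"
  assumes "c \<noteq> 0"
  shows "\<exists>p. pderiv p + smult c p = r"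
proof (induction "degree r" arbitrary: r rule: less_induct)
  case less
  show ?case
  proof (cases "degree r = 0")
    case True
    then have "pderiv r = 0"
      by (simp add: pderiv_eq_0_iff)
    then show ?thesis
      using assms by (intro exI[of _ "smult (inverse c) r"]) (simp add: pderiv_smult)
  next
    case False
    then have "degree (smult (- inverse c) (pderiv r)) < degree r"
      using assms by (simp add: degree_pderiv)
    then obtain p where "pderiv p + smult c p = smult (- inverse c) (pderiv r)"
      using less by blast
    then have "pderiv p = smult (- inverse c) (pderiv r) - smult c p"
      by (simp add: eq_diff_eq)
    then show ?thesis
      using assms
      by (intro exI[of _ "p + smult (inverse c) r"])
         (simp add: pderiv_add pderiv_smult smult_add_right)
  qed
qed

text \<open>For any solution p, the polynomial p' + iwp has degree at most n - 1, so its values at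
  the n nodes determine it: it is the interpolant. Hence the solution is the unique preimage of the
  interpolant, which also settles the \<open>THE\<close>.\<close>

lemma collocation_poly_eq:
  assumes "w \<noteq> 0" "n \<ge> 1" "inj_on X {..<n}"
  shows "pderiv (collocation_poly w n X r) + smult (\<i> * of_real w) (collocation_poly w n X r)
    = interp_poly n X r"
    and "degree (collocation_poly w n X r) \<le> n - 1"
proof -
  define c where "c = \<i> * complex_of_real w"
  have c: "c \<noteq> 0"
    using assms by (simp add: c_def)
  have "inj_on (\<lambda>j. complex_of_real (X j)) {..<n}"
    using assms(3) by (auto simp: inj_on_def)
  then obtain R where R: "degree R \<le> n - 1" "\<And>j. j < n \<Longrightarrow> poly R (of_real (X j)) = r (X j)"
    using ex_interpolating_poly[of "\<lambda>j. complex_of_real (X j)" n "\<lambda>j. r (X j)"] by blast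
  then have R_eq: "interp_poly n X r = R"
    using assms by (intro interp_poly_eqI) auto
  obtain p where p: "pderiv p + smult c p = R"
    using ex_pderiv_plus_smult_eq[OF c] by blast
  have deg: "degree p \<le> n - 1"
    using degree_pderiv_plus_smult[OF c, of p] R p by simp
  have "collocation_poly w n X r = p"
    unfolding collocation_poly_def c_def[symmetric]
  proof (rule the_equality)
    show "degree p \<le> n - 1 \<and> (\<forall>j<n. poly (pderiv p) (of_real (X j)) + c * poly p (of_real (X j)) = r (X j))"
      using deg R(2) by (simp flip: p)
  next
    fix q
    assume q: "degree q \<le> n - 1 \<and>
      (\<forall>j<n. poly (pderiv q) (of_real (X j)) + c * poly q (of_real (X j)) = r (X j))"
    then have "interp_poly n X r = pderiv q + smult c q"
      using assms degree_pderiv_plus_smult[OF c, of q] by (intro interp_poly_eqI) auto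
    then show "q = p"
      using R_eq p pderiv_plus_smult_eq_iff[OF c] by metis
  qed
  then show "pderiv (collocation_poly w n X r) + smult (\<i> * of_real w) (collocation_poly w n X r)
      = interp_poly n X r" "degree (collocation_poly w n X r) \<le> n - 1"
    using p deg R_eq by (auto simp: c_def)
qed

section \<open>The entire exponential integral\<close>

text \<open>The constant coefficient is \<open>0\<close> because of \<open>x / 0 = 0\<close>.\<close>

definition Ein :: "complex \<Rightarrow> complex" where
  "Ein z = (\<Sum>n. - ((- 1) ^ n / (of_nat n * fact n)) * z ^ n)"

lemma Ein_0 [simp]: "Ein 0 = 0"
  unfolding Ein_def by (subst powser_zero) simp

text \<open>Termwise differentiation, with the exponential series as majorant. The derivative stays
  a series so that \<open>z = 0\<close> is covered; continuity of \<open>Ein\<close> everywhere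
  rests on this.\<close>

lemma Ein_has_field_derivative_series:
  "(Ein has_field_derivative (\<Sum>n. (- 1) ^ n / fact (Suc n) * z ^ n)) (at z)"
proof -
  define c :: "nat \<Rightarrow> complex" where "c = (\<lambda>n. - ((- 1) ^ n / (of_nat n * fact n)))"
  have "summable (\<lambda>n. c n * y ^ n)" for y
  proof (rule summable_comparison_test'[where N = 0])
    show "summable (\<lambda>n. norm (y ^ n /\<^sub>R fact n))"
      by (rule summable_norm_exp)
    show "norm (c n * y ^ n) \<le> norm (y ^ n /\<^sub>R fact n)" for n
    proof (cases "n = 0")
      case False
      then have "norm y ^ n / (real n * fact n) \<le> norm y ^ n / fact n"
        by (intro divide_left_mono) auto
      then show ?thesis
        by (simp add: c_def norm_mult norm_divide norm_power divide_inverse[of _ "fact n"] mult.commute)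
    qed (simp add: c_def)
  qed
  from termdiffs_strong_converges_everywhere[OF this, of z] show ?thesis
    by (simp add: Ein_def [abs_def] c_def diffs_def del: of_nat_Suc)
qed

lemma Ein_has_field_derivative:
  assumes "z \<noteq> 0"
  shows "(Ein has_field_derivative (1 - exp (- z)) / z) (at z)"
proof -
  have "(\<lambda>n. ((- z) ^ Suc n) /\<^sub>R fact (Suc n)) sums (exp (- z) - 1)"
    using exp_converges[of "- z"] by (subst sums_Suc_iff) simp
  then have "(\<lambda>n. (((- z) ^ Suc n) /\<^sub>R fact (Suc n)) * (- 1 / z)) sums ((exp (- z) - 1) * (- 1 / z))"
    by (rule sums_mult2)
  moreover have "(((- z) ^ Suc n) /\<^sub>R fact (Suc n)) * (- 1 / z) = (- 1) ^ n / fact (Suc n) * z ^ n" for n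
    using assms
    by (simp add: scaleR_conv_of_real power_minus[of z] divide_inverse del: fact_Suc)
  ultimately have "(\<Sum>n. (- 1) ^ n / fact (Suc n) * z ^ n) = (exp (- z) - 1) * (- 1 / z)"
    by (simp only: sums_iff)
  also have "\<dots> = (1 - exp (- z)) / z"
    using assms by (simp add: field_simps)
  finally have "(\<Sum>n. (- 1) ^ n / fact (Suc n) * z ^ n) = (1 - exp (- z)) / z" .
  then show ?thesis
    using Ein_has_field_derivative_series[of z] by (simp del: fact_Suc)
qed

lemma continuous_on_Ein [continuous_intros]:
  assumes "continuous_on A f"
  shows "continuous_on A (\<lambda>x. Ein (f x))"
proof -
  have "continuous_on UNIV Ein"
    using DERIV_isCont[OF Ein_has_field_derivative_series] by (simp add: continuous_at_imp_continuous_on)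
  then show ?thesis
    using assms by (rule continuous_on_compose2) auto
qed

text \<open>The first bound is 1 + t \<le> e^t at t = -x/n. The second combines Bernoulli's
  inequality for (1 - x^2/n^2)^n = (1 - x/n)^n (1 + x/n)^n with (1 + x/n)^n \<le> e^x.\<close>

lemma exp_minus_power_bounds:
  fixes x :: real
  assumes "n \<ge> 1" "0 \<le> x" "x \<le> n"
  shows "(1 - x / n) ^ n \<le> exp (- x)"
    and "exp (- x) - (1 - x / n) ^ n \<le> x\<^sup>2 * exp (- x) / n"
proof -
  have n: "real n > 0" and r: "0 \<le> x / n" "x / n \<le> 1"
    using assms by auto
  have e: "exp (x / n) ^ n = exp x"
    using n by (simp flip: exp_of_nat_mult)
  have "(1 - x / n) ^ n \<le> exp (- (x / n)) ^ n"
    using r exp_ge_add_one_self[of "- (x / n)"] by (intro power_mono) auto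
  then show "(1 - x / n) ^ n \<le> exp (- x)"
    using n by (simp flip: exp_of_nat_mult)
  have "(x / n)\<^sup>2 \<le> 1"
    using r by (simp add: power_le_one)
  then have "1 - real n * (x / n)\<^sup>2 \<le> (1 - (x / n)\<^sup>2) ^ n"
    using Bernoulli_inequality[of "- (x / n)\<^sup>2" n] by simp
  also have "(1 - (x / n)\<^sup>2) ^ n = (1 - x / n) ^ n * (1 + x / n) ^ n"
    by (simp add: power2_eq_square algebra_simps flip: power_mult_distrib)
  also have "\<dots> \<le> (1 - x / n) ^ n * exp (x / n) ^ n"
    using r exp_ge_add_one_self[of "x / n"] by (intro mult_left_mono power_mono) auto
  also have "\<dots> = (1 - x / n) ^ n * exp x"
    by (simp add: e)
  finally have "(1 - real n * (x / n)\<^sup>2) * exp (- x) \<le> (1 - x / n) ^ n * exp x * exp (- x)"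
    by (rule mult_right_mono) simp
  then have "(1 - real n * (x / n)\<^sup>2) * exp (- x) \<le> (1 - x / n) ^ n"
    by (simp add: mult.assoc flip: exp_add)
  moreover have "real n * (x / n)\<^sup>2 = x\<^sup>2 / n"
    using n by (simp add: power2_eq_square)
  ultimately show "exp (- x) - (1 - x / n) ^ n \<le> x\<^sup>2 * exp (- x) / n"
    by (simp add: algebra_simps)
qed

text \<open>
  The sum \<open>\<Sum>\<^sub>k\<^sub>=\<^sub>1\<^sup>n (1 - (1 - x/n)\<^sup>k) / k\<close> equals the \<open>n\<close>-th harmonic number at \<open>x = n\<close>, vanishes
  at \<open>x = 0\<close>, and has the derivative \<open>(1 - (1 - x/n)\<^sup>n) / x\<close>, which is close to \<open>Ein' x\<close>.
\<close>

lemma norm_Ein_diff_harm_le: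
  assumes "n \<ge> 1"
  shows "norm (Ein (of_nat n) - harm n) \<le> 1 / n"
proof -
  define S where "S = (\<lambda>x::real. \<Sum>k=1..n. (1 - (1 - x / n) ^ k) / k)"
  define D where "D = (\<lambda>x. Ein (of_real x) - of_real (S x))"
  \<comment> \<open>An antiderivative of x e^(-x)/n, the bound for the norm of the derivative of
    \<open>D\<close>. Its increase over [0, n] is at most 1/n, since it starts at -1/n and stays
    nonpositive.\<close>
  define \<phi> where "\<phi> = (\<lambda>x::real. - (x + 1) * exp (- x) / n)"
  have n: "real n > 0"
    using assms by simp
  have S': "(S has_real_derivative (1 - (1 - x / n) ^ n) / x) (at x)" if "x > 0" for x
  proof -
    have "(S has_real_derivative (\<Sum>k=1..n. (1 - x / n) ^ (k - 1) / n)) (at x)"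
      unfolding S_def using n by (auto intro!: derivative_eq_intros sum.cong)
    also have "(\<Sum>k=1..n. (1 - x / n) ^ (k - 1) / n) = (\<Sum>k<n. (1 - x / n) ^ k) / n"
      by (simp add: sum_divide_distrib sum.atLeast1_atMost_eq)
    \<comment> \<open>A geometric sum whose ratio differs from 1 by x/n, so the factor 1/n
      cancels.\<close>
    also have "\<dots> = (1 - (1 - x / n) ^ n) / x"
      using that n by (subst sum_gp_strict) (auto simp: field_simps)
    finally show ?thesis .
  qed
  have "norm (D n - D 0) \<le> \<phi> n - \<phi> 0"
  proof (rule differentiable_bound_general)
    show "(D has_vector_derivative of_real (((1 - x / n) ^ n - exp (- x)) / x)) (at x)"
      if "0 < x" "x < real n" for x
    proof -
      have "((\<lambda>x. Ein (of_real x)) has_vector_derivative (1 - exp (- of_real x)) / of_real x) (at x)"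
        using that by (intro has_vector_derivative_real_field Ein_has_field_derivative) auto
      moreover have "((\<lambda>x. complex_of_real (S x)) has_vector_derivative
          of_real ((1 - (1 - x / n) ^ n) / x)) (at x)"
        using S' that by (intro has_vector_derivative_of_real)
          (auto simp: has_real_derivative_iff_has_vector_derivative)
      ultimately have "(D has_vector_derivative
          (1 - exp (- of_real x)) / of_real x - of_real ((1 - (1 - x / n) ^ n) / x)) (at x)"
        unfolding D_def by (rule has_vector_derivative_diff)
      also have "(1 - exp (- of_real x)) / of_real x - of_real ((1 - (1 - x / n) ^ n) / x) =
          complex_of_real (((1 - x / n) ^ n - exp (- x)) / x)"
        using that exp_of_real[of "- x", where ?'a = complex] by (simp add: field_simps)
      finally show ?thesis .
    qed
    show "(\<phi> has_vector_derivative x * exp (- x) / n) (at x)" for x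
      unfolding \<phi>_def has_real_derivative_iff_has_vector_derivative[symmetric]
      using n by (auto intro!: derivative_eq_intros simp: field_simps)
    show "norm (complex_of_real (((1 - x / n) ^ n - exp (- x)) / x)) \<le> x * exp (- x) / n"
      if "0 < x" "x < real n" for x
      using exp_minus_power_bounds[of n x] that assms
      by (simp only: norm_of_real) (simp add: abs_if field_simps power2_eq_square)
    show "continuous_on {0..real n} D"
      unfolding D_def S_def by (intro continuous_intros) (use n in auto)
    show "continuous_on {0..real n} \<phi>"
      unfolding \<phi>_def by (intro continuous_intros) (use n in auto)
  qed (use n in auto)
  moreover have "D 0 = 0"
    by (simp add: D_def S_def)
  moreover have "D n = Ein (of_nat n) - harm n"
    using n by (auto simp: D_def S_def harm_def divide_inverse power_0_left intro!: sum.cong)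
  moreover have "\<phi> n - \<phi> 0 \<le> 1 / n"
    using n by (simp add: \<phi>_def divide_le_0_iff mult_le_0_iff)
  ultimately show ?thesis
    by simp
qed

lemma Ein_minus_ln_tendsto:
  "(\<lambda>n. Ein (of_nat n) - of_real (ln (real n))) \<longlonglongrightarrow> euler_mascheroni"
proof -
  have "(\<lambda>n. Ein (of_nat n) - harm n) \<longlonglongrightarrow> 0"
  proof (rule Lim_null_comparison)
    show "\<forall>\<^sub>F n in sequentially. norm (Ein (of_nat n) - harm n) \<le> 1 / n"
      using eventually_ge_at_top[of 1] by eventually_elim (rule norm_Ein_diff_harm_le)
    show "(\<lambda>n. 1 / real n) \<longlonglongrightarrow> 0"
      by real_asymp
  qed
  from tendsto_add[OF this euler_mascheroni_LIMSEQ_of_real] show ?thesis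
    by (simp add: of_real_harm)
qed

section \<open>The incomplete Gamma function\<close>

lemma Ln_minus_Ein_has_field_derivative:
  assumes "z \<notin> \<real>\<^sub>\<le>\<^sub>0"
  shows "((\<lambda>z. Ln z - Ein z) has_field_derivative exp (- z) / z) (at z)"
proof -
  have "z \<noteq> 0"
    using assms by auto
  then show ?thesis
    using assms by (auto intro!: derivative_eq_intros Ein_has_field_derivative simp: field_simps)
qed

text \<open>The half-plane Re t \<ge> n is convex, avoids the cut for n \<ge> 1 and contains both n
  and z + n. The derivative is at most e^(-n)/n there, so the values at these two points share their
  limit, which is known along the integers.\<close>

lemma Ln_minus_Ein_tendsto:
  assumes "Re z \<ge> 0"
  shows "(\<lambda>n. Ln (z + of_nat n) - Ein (z + of_nat n)) \<longlonglongrightarrow> - euler_mascheroni"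
proof -
  define P where "P = (\<lambda>z. Ln z - Ein z)"
  have "(\<lambda>n. P (z + of_nat n) - P (of_nat n)) \<longlonglongrightarrow> 0"
  proof (rule Lim_null_comparison)
    show "\<forall>\<^sub>F n in sequentially. norm (P (z + of_nat n) - P (of_nat n)) \<le> exp (- real n) / n * norm z"
      using eventually_ge_at_top[of 1]
    proof eventually_elim
      case (elim n)
      have "norm (P (z + of_nat n) - P (of_nat n)) \<le> exp (- real n) / n * norm (z + of_nat n - of_nat n)"
      proof (rule field_differentiable_bound)
        show "convex {t. Re t \<ge> real n}"
          by (rule convex_halfspace_Re_ge)
        show "(P has_field_derivative exp (- t) / t) (at t within {t. real n \<le> Re t})"
          if "t \<in> {t. real n \<le> Re t}" for t
          unfolding P_def using that elim
          by (intro DERIV_subset[OF Ln_minus_Ein_has_field_derivative])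
             (auto simp: complex_nonpos_Reals_iff)
        show "norm (exp (- t) / t) \<le> exp (- real n) / n" if "t \<in> {t. real n \<le> Re t}" for t
        proof -
          have "real n \<le> norm t"
            using that complex_Re_le_cmod[of t] by simp
          then show ?thesis
            unfolding norm_divide norm_exp_eq_Re using that elim by (intro frac_le) auto
        qed
      qed (use assms in auto)
      then show ?case by simp
    qed
    show "(\<lambda>n. exp (- real n) / n * norm z) \<longlonglongrightarrow> 0"
      by real_asymp
  qed
  moreover have "(\<lambda>n. P (of_nat n)) \<longlonglongrightarrow> - euler_mascheroni"
  proof (rule Lim_transform_eventually)
    show "(\<lambda>n. - (Ein (of_nat n) - of_real (ln (real n)))) \<longlonglongrightarrow> - euler_mascheroni"
      by (intro tendsto_minus Ein_minus_ln_tendsto)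
    show "\<forall>\<^sub>F n in sequentially. - (Ein (of_nat n) - of_real (ln (real n))) = P (of_nat n)"
      using eventually_ge_at_top[of 1]
    proof eventually_elim
      case (elim n)
      then show ?case
        using Ln_of_real[of "real n"] by (simp add: P_def)
    qed
  qed
  ultimately have "(\<lambda>n. P (z + of_nat n) - P (of_nat n) + P (of_nat n)) \<longlonglongrightarrow> 0 + - euler_mascheroni"
    by (rule tendsto_add)
  then show ?thesis
    by (simp add: P_def)
qed

text \<open>Truncated at k, the integral is a difference of values of the primitive
  \<open>P\<close>; dominated convergence lets k tend to infinity. The closed half-plane includes
  the imaginary axis, where the arguments -iwx lie.\<close>

theorem Gamma_inc0_eq:
  assumes "Re z \<ge> 0" "z \<noteq> 0"
  shows "Gamma_inc0 z = Ein z - Ln z - euler_mascheroni"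
proof -
  define g where "g = (\<lambda>s::real. exp (- (z + of_real s)) / (z + of_real s))"
  define P where "P = (\<lambda>z. Ln z - Ein z)"
  have cut: "z + of_real s \<notin> \<real>\<^sub>\<le>\<^sub>0" if "s \<ge> 0" for s
    using assms that by (auto simp: complex_nonpos_Reals_iff complex_eq_iff)
  have "(g has_integral (- euler_mascheroni - P z)) {0..}"
  proof (rule has_integral_dominated_convergence)
    fix k :: nat
    have "(g has_integral (P (z + of_real k) - P (z + of_real 0))) {0..real k}"
    proof (rule fundamental_theorem_of_calculus)
      fix s assume "s \<in> {0..real k}"
      then have "(P has_field_derivative exp (- (z + of_real s)) / (z + of_real s)) (at (z + of_real s))"
        unfolding P_def using cut by (intro Ln_minus_Ein_has_field_derivative) auto
      then have "((\<lambda>s. P (z + s)) has_field_derivative g s) (at (of_real s))"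
        by (simp add: g_def add.commute[of z] DERIV_shift)
      then show "((\<lambda>s. P (z + of_real s)) has_vector_derivative g s) (at s within {0..real k})"
        by (rule has_vector_derivative_real_field)
    qed simp
    then show "((\<lambda>s. if s \<in> {0..real k} then g s else 0) has_integral (P (z + of_nat k) - P z)) {0..}"
      by (subst has_integral_restrict) auto
  next
    show "(\<lambda>s. exp (- 1 * s) / norm z) integrable_on {0..}"
      by (intro integrable_on_divide integrable_on_exp_minus_to_infinity) simp
    have "norm (g s) \<le> exp (- 1 * s) / norm z" if "s \<ge> 0" for s
    proof -
      \<comment> \<open>Moving right from a point with nonnegative real part only increases the
        modulus; this keeps the majorant free of a singularity at \<open>s = 0\<close>.\<close>
      have "norm z \<le> norm (z + of_real s)"
        unfolding cmod_def using assms that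
        by (intro real_sqrt_le_mono add_right_mono power_mono) auto
      then show ?thesis
        unfolding g_def norm_divide norm_exp_eq_Re using assms by (intro frac_le) auto
    qed
    then show "\<forall>s\<in>{0..}. norm (if s \<in> {0..real k} then g s else 0) \<le> exp (- 1 * s) / norm z" for k
      by auto
    show "\<forall>s\<in>{0..}. (\<lambda>k. if s \<in> {0..real k} then g s else 0) \<longlonglongrightarrow> g s"
    proof
      fix s :: real assume "s \<in> {0..}"
      have "\<forall>\<^sub>F k in sequentially. s \<le> real k"
        by (rule eventually_sequentiallyI[of "nat \<lceil>s\<rceil>"]) linarith
      then show "(\<lambda>k. if s \<in> {0..real k} then g s else 0) \<longlonglongrightarrow> g s"
        using \<open>s \<in> {0..}\<close> by (intro tendsto_eventually) (simp add: eventually_mono)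
    qed
    show "(\<lambda>k. P (z + of_nat k) - P z) \<longlonglongrightarrow> - euler_mascheroni - P z"
      unfolding P_def using assms by (intro tendsto_diff tendsto_const Ln_minus_Ein_tendsto)
  qed
  then show ?thesis
    by (simp add: Gamma_inc0_def g_def P_def integral_unique)
qed

section \<open>Levin and Filon quadrature agree\<close>

text \<open>The exponentials cancel, and so do the logarithm and Euler's constant. What remains is
  smooth in x and covers x = 0, where both sides vanish.\<close>

lemma levin_h2_times_osc:
  assumes "w \<noteq> 0"
  shows "levin_h2 w n X f x * osc w x = poly (levin_q1 w n X f) 0 * Ein (- \<i> * of_real w * of_real x)"
proof (cases "x = 0")
  case False
  define z where "z = - \<i> * complex_of_real w * of_real x"
  have "exp z * osc w x = 1"
    by (simp add: z_def osc_def flip: exp_add)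
  moreover have "Gamma_inc0 z = Ein z - Ln z - euler_mascheroni"
    using assms False by (intro Gamma_inc0_eq) (auto simp: z_def)
  ultimately show ?thesis
    using False unfolding levin_h2_def Let_def z_def[symmetric] by (simp add: mult_ac)
qed (simp add: levin_h2_def)

lemma osc_has_vector_derivative:
  "(osc w has_vector_derivative \<i> * of_real w * osc w x) (at x within S)"
proof -
  have "((\<lambda>z. exp (\<i> * of_real w * z)) has_field_derivative \<i> * of_real w * osc w x) (at (of_real x))"
    by (auto intro!: derivative_eq_intros simp: osc_def)
  from has_vector_derivative_real_field[OF this] show ?thesis
    by (simp add: osc_def [abs_def])
qed

lemma levin_primitive_eq:
  assumes "w \<noteq> 0" "x \<noteq> 0"
  shows "levin_primitive w n X f x =
    (poly (levin_q1 w n X f) (of_real x) * osc w x - poly (levin_q1 w n X f) 0) * of_real (ln x)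
    + poly (levin_h1 w n X f) (of_real x) * osc w x
    + poly (levin_q1 w n X f) 0 * Ein (- \<i> * of_real w * of_real x)"
proof -
  have "osc w (- x) * osc w x = 1"
    by (simp add: osc_def flip: exp_add)
  then show ?thesis
    using assms by (simp add: levin_primitive_def levin_q_def levin_h2_times_osc left_diff_distrib mult.assoc)
qed

lemma levin_primitive_has_vector_derivative:
  assumes "w \<noteq> 0" "n \<ge> 1" "inj_on X {..<n}" "x > 0"
  shows "(levin_primitive w n X f has_vector_derivative
    poly (interp_poly n X f) (of_real x) * of_real (ln x) * osc w x) (at x)"
proof -
  define c where "c = \<i> * complex_of_real w"
  define q where "q = levin_q1 w n X f"
  define h where "h = levin_h1 w n X f"
  \<comment> \<open>Writing q = b + x r identifies \<open>levin_q2\<close> with the polynomial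
    \<open>r\<close>, also at x = 0, where q'(0) = r(0).\<close>
  obtain b r where q_eq: "q = pCons b r"
    by (cases q)
  have q: "pderiv q + smult c q = interp_poly n X f" and "degree q \<le> n - 1"
    using collocation_poly_eq[OF assms(1-3)] by (auto simp: q_def levin_q1_def c_def)
  then have "degree r \<le> n - 1"
    by (auto simp: q_eq split: if_splits)
  \<comment> \<open>By its degree bound, -r is its own interpolant, so the collocation equation for
    \<open>h\<close> holds identically.\<close>
  then have "interp_poly n X (\<lambda>x. - levin_q2 w n X f x) = - r"
    using assms q_eq
    by (intro interp_poly_eqI) (auto simp: levin_q2_def Let_def pderiv_pCons simp flip: q_def)
  then have h: "pderiv h + smult c h = - r"
    using collocation_poly_eq[OF assms(1-3)] by (simp add: h_def levin_h1_def c_def)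
  define \<Phi> where "\<Phi> = (\<lambda>x. (poly q (of_real x) * osc w x - b) * of_real (ln x)
    + poly h (of_real x) * osc w x + b * Ein (- c * of_real x))"
  have eq: "levin_primitive w n X f y = \<Phi> y" if "y > 0" for y
    using that assms by (simp add: levin_primitive_eq \<Phi>_def c_def q_eq flip: q_def h_def)
  have poly: "((\<lambda>x. poly p (complex_of_real x)) has_vector_derivative poly (pderiv p) (of_real x)) (at x)" for p
    by (rule has_vector_derivative_real_field) (rule poly_DERIV)
  have ln: "((\<lambda>x. complex_of_real (ln x)) has_vector_derivative of_real (1 / x)) (at x)"
    using assms(4) by (intro has_vector_derivative_of_real)
      (auto intro!: derivative_eq_intros simp flip: has_real_derivative_iff_has_vector_derivative)
  have Ein: "((\<lambda>x. Ein (- c * of_real x)) has_vector_derivative (1 - osc w x) / of_real x) (at x)"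
  proof (rule has_vector_derivative_real_field)
    have "- c * of_real x \<noteq> 0"
      using assms by (simp add: c_def)
    from DERIV_chain2[OF Ein_has_field_derivative[OF this] DERIV_cmult_Id]
    have "((\<lambda>x. Ein (- c * x)) has_field_derivative
        (1 - osc w x) / (- c * of_real x) * - c) (at (of_real x))"
      by (simp add: c_def osc_def)
    also have "(1 - osc w x) / (- c * of_real x) * - c = (1 - osc w x) / of_real x"
      using assms by (simp add: c_def)
    finally show "((\<lambda>x. Ein (- c * x)) has_field_derivative (1 - osc w x) / of_real x) (at (of_real x))" .
  qed
  have osc: "(osc w has_vector_derivative c * osc w x) (at x)"
    unfolding c_def by (rule osc_has_vector_derivative)
  have q': "poly (pderiv q) (of_real x) = poly (interp_poly n X f) (of_real x) - c * poly q (of_real x)"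
    by (simp flip: q)
  have "poly (pderiv h + smult c h) (of_real x) = - poly r (of_real x)"
    by (simp only: h poly_minus)
  then have h': "poly (pderiv h) (of_real x) = - poly r (of_real x) - c * poly h (of_real x)"
    by (simp add: algebra_simps)
  have "(\<Phi> has_vector_derivative
    (poly q (of_real x) * osc w x - b) * of_real (1 / x)
     + (poly q (of_real x) * (c * osc w x) + poly (pderiv q) (of_real x) * osc w x - 0) * of_real (ln x)
     + (poly h (of_real x) * (c * osc w x) + poly (pderiv h) (of_real x) * osc w x)
     + b * ((1 - osc w x) / of_real x)) (at x)"
    unfolding \<Phi>_def
    by (intro has_vector_derivative_add has_vector_derivative_diff has_vector_derivative_mult
        has_vector_derivative_const has_vector_derivative_mult_right poly ln Ein osc)
  \<comment> \<open>As q = b + x r, the two quotients by x add up to r e^(iwx), which the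
    \<open>h\<close> terms cancel. The logarithmic terms leave (q' + iwq) e^(iwx) log x.\<close>
  also have "(poly q (of_real x) * osc w x - b) * of_real (1 / x)
     + (poly q (of_real x) * (c * osc w x) + poly (pderiv q) (of_real x) * osc w x - 0) * of_real (ln x)
     + (poly h (of_real x) * (c * osc w x) + poly (pderiv h) (of_real x) * osc w x)
     + b * ((1 - osc w x) / of_real x) = poly (interp_poly n X f) (of_real x) * of_real (ln x) * osc w x"
    unfolding q' h' using assms(4) by (simp add: q_eq field_simps)
  finally show ?thesis
  proof (rule has_vector_derivative_transform_within_open)
    show "\<Phi> y = levin_primitive w n X f y" if "y \<in> {0<..}" for y
      using that by (simp add: eq)
  qed (use assms(4) in auto)
qed

text \<open>Differentiability handles x > 0. At 0 the logarithmic term has limit 0, and the rest,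
  \<open>R\<close>, is continuous because its \<open>levin_h2\<close> part is a multiple of
  \<open>Ein\<close>.\<close>

lemma continuous_on_levin_primitive:
  assumes "w \<noteq> 0" "n \<ge> 1" "inj_on X {..<n}"
  shows "continuous_on {0..} (levin_primitive w n X f)"
  unfolding continuous_on_eq_continuous_within
proof
  fix x :: real assume "x \<in> {0..}"
  show "continuous (at x within {0..}) (levin_primitive w n X f)"
  proof (cases "x = 0")
    case False
    then have "x > 0"
      using \<open>x \<in> {0..}\<close> by simp
    from has_vector_derivative_continuous[OF levin_primitive_has_vector_derivative[OF assms this]]
    show ?thesis
      by (rule continuous_at_imp_continuous_at_within)
  next
    case True
    define R where "R = (\<lambda>x. poly (levin_h1 w n X f) (of_real x) * osc w x + levin_h2 w n X f x * osc w x)"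
    have "continuous_on UNIV R"
      unfolding R_def levin_h2_times_osc[OF assms(1)]
      unfolding osc_def by (intro continuous_intros)
    then have "(R \<longlongrightarrow> R 0) (at_right 0)"
      by (auto simp: continuous_on_eq_continuous_within continuous_within intro: tendsto_within_subset)
    from tendsto_add[OF levin_log_term_tendsto_0[of w n X f] this]
    have "((\<lambda>x. levin_q w n X f x * osc w x * of_real (ln x) + R x) \<longlongrightarrow> levin_primitive w n X f 0)
        (at_right 0)"
      by (simp add: R_def levin_primitive_def)
    then have "(levin_primitive w n X f \<longlongrightarrow> levin_primitive w n X f 0) (at_right 0)"
      by (rule Lim_transform_eventually)
         (auto simp: eventually_at_filter levin_primitive_def R_def)
    then show ?thesis
      using True by (simp add: continuous_within at_within_Ici_at_right)
  qed
qed

theorem theorem3p1: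
  fixes a w :: real and n :: nat and f :: "real \<Rightarrow> complex" and X :: "nat \<Rightarrow> real"
  assumes "a > 0" and "w \<noteq> 0" and "n \<ge> 1"
    and "\<exists>f'. (\<forall>x\<in>{0..a}. (f has_vector_derivative f' x) (at x within {0..a}))
              \<and> continuous_on {0..a} f'"
    and "0 \<le> X 0" and "strict_mono_on {..<n} X" and "X (n - 1) \<le> a"
  shows "levin_quadrature a w n X f = filon_quadrature a w n X f"
proof -
  have inj: "inj_on X {..<n}"
    using assms(6) by (rule strict_mono_on_imp_inj_on)
  \<comment> \<open>The integrand may be unbounded near 0, so the fundamental theorem is used in the
    form that asks for the derivative only on the open interval and for continuity of the primitive
    on the closed one.\<close>
  have "((\<lambda>x. poly (interp_poly n X f) (of_real x) * of_real (ln x) * osc w x) has_integral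
      (levin_primitive w n X f a - levin_primitive w n X f 0)) {0..a}"
    using assms(1-3) inj
    by (intro fundamental_theorem_of_calculus_interior levin_primitive_has_vector_derivative
        continuous_on_subset[OF continuous_on_levin_primitive]) auto
  then show ?thesis
    by (simp add: levin_quadrature_def filon_quadrature_def integral_unique)
qed

end
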